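(* Let $H:[0,1)\to[0,\infty)$ be an increasing function and let $\alpha\in(\tfrac12,1)$. Then the following hold. (1) If there exists a constant $c_1\ge 1$ such that $$H(t)\le c_1\frac{(1-\log(1-t))^{-\alpha}}{1-t}\quad\text{for all }t\in[0,1),$$ then $$A_n(H)\le\frac{c}{\sqrt{n^{2\alpha-1}}}\quad\text{for all }n\in\mathbb{N},$$ where $c\ge 1$ is a constant depending only on $\alpha$ and $c_1$. (2) If there exist $s\in[0,1)$ and a constant $c_2\ge 1$ such that $$H(t)\ge\frac{1}{c_2}\frac{(1-\log(1-t))^{-\alpha}}{1-t}\quad\text{for all }t\in[s,1),$$ then $$A_n(H)\ge\frac{1}{c}\frac{1}{\sqrt{n^{2\alpha-1}}}\quad\text{for all }n\in\mathbb{N},$$ where $c\ge 1$ is a constant depending only on $s$, $\alpha$ and $c_2$.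
   Context: "Increasing" means non-decreasing, and $\mathbb{N}=\{1,2,\dots\}$. For $n\in\mathbb{N}$ let $\mathcal{T}_n:=\{\tau=(t_i)_{i=0}^n:\ 0=t_0<t_1<\cdots<t_n=1\}$. For a non-negative measurable function $H$ on $[0,1)$ define $$A_n(H):=\inf_{\tau\in\mathcal{T}_n}\left(\sum_{i=1}^n\int_{t_{i-1}}^{t_i}(t_i-t)H^2(t)\,dt\right)^{1/2}\in[0,\infty].$$ *)

theory Defs
  imports "HOL-Analysis.Analysis"
begin

(* The library has no square root on ennreal; esqrt extends sqrt by esqrt \<infinity> = \<infinity>.
   The two lemmas pin it down as the inverse of squaring. *)
definition esqrt :: "ennreal \<Rightarrow> ennreal" where
  "esqrt x = (if x = \<infinity> then \<infinity> else ennreal (sqrt (enn2real x)))"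

lemma esqrt_ennreal: "0 \<le> r \<Longrightarrow> esqrt (ennreal r) = ennreal (sqrt r)"
  by (simp add: esqrt_def)

lemma esqrt_power2: "(esqrt x)\<^sup>2 = x"
  by (cases x) (simp_all add: esqrt_def power2_eq_square ennreal_mult[symmetric])

(* A net (t_i), i = 0..n, is encoded as a function on nat; its values beyond n are unconstrained
   and play no role. *)
definition nets :: "nat \<Rightarrow> (nat \<Rightarrow> real) set" where
  "nets n = {\<tau>. \<tau> 0 = 0 \<and> \<tau> n = 1 \<and> (\<forall>i<n. \<tau> i < \<tau> (Suc i))}"

(* H is a total function, but only its values on [0,1) matter: the integrals are taken over
   half-open intervals, so that H 1 is never used. On the domain of integration the argument
   of ennreal is non-negative. *)
definition A :: "nat \<Rightarrow> (real \<Rightarrow> real) \<Rightarrow> ennreal" where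
  "A n H = (INF \<tau>\<in>nets n.
     esqrt (\<Sum>i=1..n. \<integral>\<^sup>+t\<in>{\<tau> (i - 1)..<\<tau> i}. ennreal ((\<tau> i - t) * (H t)\<^sup>2) \<partial>lborel))"

end

theory Submission
  imports Defs "HOL-Real_Asymp.Real_Asymp"
begin

text \<open>
  Write \<open>L t = 1 - log (1 - t)\<close> and measure time by \<open>u = L t\<close>, which maps \<open>[0,1)\<close> increasingly
  onto \<open>[1,\<infinity>)\<close>. Since \<open>dL = dt / (1 - t)\<close>, the cost of an interval \<open>[a,b)\<close> for the model
  function \<open>h t = L t powr (- \<alpha>) / (1 - t)\<close> becomes
  \<open>\<integral> (1 - exp (u - L b)) * u powr (- 2\<alpha>) du\<close> over \<open>[L a, L b)\<close>, with \<open>L 1 = \<infinity>\<close>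
  for the last interval. The first factor is at most \<open>L b - u\<close>, and it is bounded below as soon as
  \<open>u\<close> is at distance \<open>1\<close> or more from \<open>L b\<close>. The squared infimum thus has the order
  \<open>n powr (1 - 2\<alpha>)\<close>, for the following two reasons.

  Upper bound. An interval of length \<open>\<delta>\<close> starting at \<open>u\<close> costs at most \<open>\<delta>\<^sup>2 * u powr (- 2\<alpha>)\<close>, so
  the cost is spread evenly if \<open>\<delta>\<close> is proportional to \<open>u powr \<alpha>\<close>. Letting \<open>du/di\<close> be
  proportional to \<open>u powr \<alpha>\<close> suggests the net with \<open>u\<^sub>i = (1 + i * n powr (- \<alpha>)) powr (1 / (1 - \<alpha>))\<close>: each bounded
  interval costs \<open>O(n powr (- 2\<alpha>))\<close>, and \<open>u\<close> reaches \<open>n\<close> just before the last, unbounded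
  interval, whose cost is \<open>\<integral> u powr (- 2\<alpha>) du\<close> over \<open>[n,\<infinity>)\<close>, again of order
  \<open>n powr (1 - 2\<alpha>)\<close> (lemmas \<open>cost_le_L_diff_square\<close>, \<open>cost_last_le\<close> and \<open>A_le\<close>).

  Lower bound. Look at the window \<open>[L s, L s + 2n]\<close>. The points that have a net point within
  distance \<open>1\<close> to their right fill at most half of it. On the rest, which has length at least
  \<open>n\<close>, the integrand is at least a constant times \<open>n powr (- 2\<alpha>)\<close>
  (lemmas \<open>cost_ge_L_diff\<close> and \<open>le_A\<close>).

  Both halves compare \<open>H\<close> with \<open>h\<close> pointwise.
\<close>

section \<open>The logarithmic time scale\<close>

definition L :: "real \<Rightarrow> real" where
  "L t = 1 - ln (1 - t)"

definition L_inv :: "real \<Rightarrow> real" where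
  "L_inv u = 1 - exp (1 - u)"

lemma L_inv_less_1: "L_inv u < 1"
  by (simp add: L_inv_def)

lemma L_L_inv [simp]: "L (L_inv u) = u"
  by (simp add: L_def L_inv_def)

lemma L_inv_less_iff [simp]: "L_inv u < L_inv v \<longleftrightarrow> u < v"
  by (simp add: L_inv_def)

lemma L_mono: "a \<le> b \<Longrightarrow> b < 1 \<Longrightarrow> L a \<le> L b"
  by (simp add: L_def)

lemma L_less_iff: "a < 1 \<Longrightarrow> b < 1 \<Longrightarrow> L a < L b \<longleftrightarrow> a < b"
  by (simp add: L_def)

lemma L_ge_1: "0 \<le> t \<Longrightarrow> t < 1 \<Longrightarrow> 1 \<le> L t"
  using L_mono[of 0 t] by (simp add: L_def)

lemma L_deriv: "t < 1 \<Longrightarrow> (L has_real_derivative 1 / (1 - t)) (at t within S)"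
  unfolding L_def by (auto intro!: derivative_eq_intros simp: divide_simps)

text \<open>
  This is \<open>log x \<le> x - 1\<close> for the ratio \<open>x = (1 - b) / (1 - t)\<close>. It turns the weight of the cost
  into a distance on the logarithmic scale, and its factor \<open>1 - t\<close> cancels one of the two factors
  in the denominator of the squared model function.
\<close>

lemma gap_le_L_diff:
  assumes "t < 1" "b < 1"
  shows "b - t \<le> (1 - t) * (L b - L t)"
proof -
  have "ln ((1 - b) / (1 - t)) \<le> (1 - b) / (1 - t) - 1"
    using assms by (intro ln_le_minus_one) simp
  also have "ln ((1 - b) / (1 - t)) = L t - L b"
    using assms by (simp add: L_def ln_div)
  finally have "(b - t) / (1 - t) \<le> L b - L t"
    using assms by (simp add: field_simps)
  then show ?thesis using assms by (simp add: field_simps)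
qed

lemma square_of_model:
  assumes "0 \<le> t" "t < 1"
  shows "(L t powr (- \<alpha>) / (1 - t))\<^sup>2 = L t powr (- (2 * \<alpha>)) / (1 - t)\<^sup>2"
proof -
  have "(L t powr (- \<alpha>))\<^sup>2 = L t powr (- (2 * \<alpha>))"
    by (simp add: power2_eq_square powr_add[symmetric])
  then show ?thesis by (simp add: power_divide)
qed

lemma nn_integral_L_length:
  assumes "a \<le> b" "b < 1" "0 \<le> k"
  shows "(\<integral>\<^sup>+t\<in>{a..b}. ennreal (k / (1 - t)) \<partial>lborel) = ennreal (k * (L b - L a))"
proof -
  have "(\<integral>\<^sup>+t. ennreal (k / (1 - t)) * indicator {a..b} t \<partial>lborel) = ennreal (k * L b - k * L a)"
  proof (rule nn_integral_FTC_Icc)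
    fix t assume "t \<in> {a..b}"
    then show "DERIV (\<lambda>t. k * L t) t :> k / (1 - t)"
      using assms DERIV_cmult[OF L_deriv[of t], of k] by simp
  qed (use assms in auto)
  then show ?thesis by (simp add: right_diff_distrib)
qed

text \<open>
  On the logarithmic scale this is the integral of \<open>u powr (- 2\<alpha>)\<close> over \<open>[L a, \<infinity>)\<close>. It converges
  because \<open>2\<alpha> > 1\<close>, and this keeps the cost of the last interval of a net finite.
\<close>

lemma nn_integral_model_tail:
  assumes \<alpha>: "1 / 2 < \<alpha>" and a: "0 \<le> a" "a < 1"
  shows "(\<integral>\<^sup>+t\<in>{a..<1}. ennreal (L t powr (- (2 * \<alpha>)) / (1 - t)) \<partial>lborel)
    \<le> ennreal (L a powr (1 - 2 * \<alpha>) / (2 * \<alpha> - 1))"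
proof -
  let ?f = "\<lambda>t. L t powr (- (2 * \<alpha>)) / (1 - t)"
  let ?F = "\<lambda>t. - (L t powr (1 - 2 * \<alpha>)) / (2 * \<alpha> - 1)"
  have pos: "0 < L t" if "a \<le> t" "t < 1" for t
    using L_ge_1[of t] that a by simp
  have deriv: "(?F has_real_derivative ?f t) (at t)" if "a \<le> t" "t < 1" for t
    using that pos[OF that] \<alpha>
    by (auto intro!: derivative_eq_intros L_deriv simp: divide_simps) (simp add: algebra_simps)
  have contL: "isCont L t" if "t < 1" for t
    using DERIV_isCont[OF L_deriv[OF that]] by simp
  have lim_a: "(?F \<longlongrightarrow> ?F a) (at_right a)"
    using DERIV_isCont[OF deriv[of a]] a unfolding isCont_def
    by (auto intro: tendsto_mono[OF at_le])
  have lim_L: "filterlim L at_top (at_left 1)"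
    unfolding L_def by real_asymp
  have lim_1: "(?F \<longlongrightarrow> 0) (at_left 1)"
  proof -
    have "((\<lambda>t. L t powr (1 - 2 * \<alpha>)) \<longlongrightarrow> 0) (at_left 1)"
      by (rule tendsto_neg_powr[OF _ lim_L]) (use \<alpha> in auto)
    then have "((\<lambda>t. - (L t powr (1 - 2 * \<alpha>)) / (2 * \<alpha> - 1)) \<longlongrightarrow> - 0 / (2 * \<alpha> - 1)) (at_left 1)"
      by (intro tendsto_intros) (use \<alpha> in auto)
    then show ?thesis by simp
  qed
  \<comment> \<open>The function \<open>L\<close> is unbounded at \<open>1\<close>, hence the improper version of the fundamental theorem.\<close>
  have FTC: "set_integrable lborel (einterval (ereal a) (ereal 1)) ?f"
    "(LBINT t=ereal a..ereal 1. ?f t) = 0 - ?F a"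
  proof (rule_tac [!] interval_integral_FTC_nonneg[where F = ?F])
    show "ereal a < ereal 1" "ereal a < ereal 1" using a by auto
    fix t assume t: "ereal a < ereal t" "ereal t < ereal 1"
    then show "DERIV ?F t :> ?f t" "DERIV ?F t :> ?f t" using deriv[of t] by auto
    have "0 < L t" using pos t by auto
    then show "isCont ?f t" "isCont ?f t"
      using t contL[of t] by (auto intro!: continuous_intros)
  next
    show "AE t in lborel. ereal a < ereal t \<longrightarrow> ereal t < ereal 1 \<longrightarrow> 0 \<le> ?f t"
      "AE t in lborel. ereal a < ereal t \<longrightarrow> ereal t < ereal 1 \<longrightarrow> 0 \<le> ?f t"
      by auto
    show "((?F \<circ> real_of_ereal) \<longlongrightarrow> ?F a) (at_right (ereal a))"
      "((?F \<circ> real_of_ereal) \<longlongrightarrow> ?F a) (at_right (ereal a))"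
      using lim_a ereal_tendsto_simps by (auto simp: ereal_tendsto_simps)
    show "((?F \<circ> real_of_ereal) \<longlongrightarrow> 0) (at_left (ereal 1))"
      "((?F \<circ> real_of_ereal) \<longlongrightarrow> 0) (at_left (ereal 1))"
      using lim_1 by (auto simp: ereal_tendsto_simps)
  qed
  have "(\<integral>\<^sup>+t\<in>{a..<1}. ennreal (?f t) \<partial>lborel)
      = (\<integral>\<^sup>+t. ennreal (indicator {a<..<1} t *\<^sub>R ?f t) \<partial>lborel)"
  proof (rule nn_integral_cong_AE)
    show "AE t in lborel. ennreal (?f t) * indicator {a..<1} t
        = ennreal (indicator {a<..<1} t *\<^sub>R ?f t)"
      using AE_lborel_singleton[of a] by eventually_elim (auto split: split_indicator)
  qed
  also have "\<dots> = ennreal (LINT t|lborel. indicator {a<..<1} t *\<^sub>R ?f t)"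
    by (rule nn_integral_eq_integral)
      (use FTC(1) in \<open>auto simp: set_integrable_def split: split_indicator\<close>)
  also have "(LINT t|lborel. indicator {a<..<1} t *\<^sub>R ?f t) = - ?F a"
    using FTC(2) a by (simp add: interval_lebesgue_integral_def set_lebesgue_integral_def)
  finally show ?thesis by simp
qed

section \<open>Comparing extended square roots with real bounds\<close>

lemma esqrt_le_ennrealI:
  assumes "x \<le> ennreal (b\<^sup>2)" "0 \<le> b"
  shows "esqrt x \<le> ennreal b"
proof (cases x)
  case (real r)
  then have "r \<le> b\<^sup>2" using assms by simp
  then have "sqrt r \<le> b" using assms(2) by (simp add: real_le_lsqrt)
  then show ?thesis using real by (simp add: esqrt_ennreal ennreal_leI)
qed (use assms in \<open>simp add: top_unique\<close>)

lemma ennreal_le_esqrtI: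
  assumes "ennreal (b\<^sup>2) \<le> x" "0 \<le> b"
  shows "ennreal b \<le> esqrt x"
proof (cases x)
  case (real r)
  then have "b\<^sup>2 \<le> r" using assms by simp
  then have "b \<le> sqrt r" by (simp add: real_le_rsqrt)
  then show ?thesis using real by (simp add: esqrt_ennreal ennreal_leI)
qed (simp add: esqrt_def)

section \<open>Upper bound\<close>

text \<open>
  One factor \<open>L b - L a\<close> bounds the weight \<open>(b - t) / (1 - t)\<close>, the other one is the length of the
  interval; the remaining factor of the integrand is largest at the left end.
\<close>

lemma cost_le_L_diff_square:
  assumes H0: "\<forall>t\<in>{0..<1}. 0 \<le> H t"
    and H: "\<forall>t\<in>{0..<1}. H t \<le> c1 * (L t powr (- \<alpha>) / (1 - t))"
    and "0 \<le> a" "a \<le> b" "b < 1" "0 \<le> \<alpha>"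
  shows "(\<integral>\<^sup>+t\<in>{a..<b}. ennreal ((b - t) * (H t)\<^sup>2) \<partial>lborel)
    \<le> ennreal (c1\<^sup>2 * (L b - L a)\<^sup>2 * L a powr (- (2 * \<alpha>)))"
proof -
  let ?k = "c1\<^sup>2 * (L b - L a) * L a powr (- (2 * \<alpha>))"
  have Lab: "L a \<le> L b" using L_mono assms by blast
  have "(\<integral>\<^sup>+t\<in>{a..<b}. ennreal ((b - t) * (H t)\<^sup>2) \<partial>lborel)
      \<le> (\<integral>\<^sup>+t\<in>{a..b}. ennreal (?k / (1 - t)) \<partial>lborel)"
  proof (rule nn_integral_mono)
    fix t
    show "ennreal ((b - t) * (H t)\<^sup>2) * indicator {a..<b} t
        \<le> ennreal (?k / (1 - t)) * indicator {a..b} t"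
    proof (cases "t \<in> {a..<b}")
      case True
      then have t: "0 \<le> t" "t < 1" "a \<le> t" "t < b" using assms by auto
      have LaLt: "L a \<le> L t" using t L_mono by blast
      have La1: "1 \<le> L a" using L_ge_1 assms by simp
      have "(H t)\<^sup>2 \<le> (c1 * (L t powr (- \<alpha>) / (1 - t)))\<^sup>2"
        using H0 H t by (intro power_mono) auto
      also have "\<dots> = c1\<^sup>2 * (L t powr (- (2 * \<alpha>)) / (1 - t)\<^sup>2)"
        using square_of_model[OF t(1,2)] by (simp only: power_mult_distrib)
      also have "\<dots> \<le> c1\<^sup>2 * (L a powr (- (2 * \<alpha>)) / (1 - t)\<^sup>2)"
        using La1 LaLt assms
        by (intro mult_left_mono divide_right_mono powr_mono2') auto
      finally have H2: "(H t)\<^sup>2 \<le> c1\<^sup>2 * (L a powr (- (2 * \<alpha>)) / (1 - t)\<^sup>2)" .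
      have "b - t \<le> (1 - t) * (L b - L t)"
        using gap_le_L_diff t assms by simp
      also have "\<dots> \<le> (1 - t) * (L b - L a)"
        using LaLt t by (intro mult_left_mono) auto
      finally have "(b - t) * (H t)\<^sup>2
          \<le> ((1 - t) * (L b - L a)) * (c1\<^sup>2 * (L a powr (- (2 * \<alpha>)) / (1 - t)\<^sup>2))"
        using H2 t Lab by (intro mult_mono) auto
      also have "\<dots> = ?k / (1 - t)"
        using t by (simp add: power2_eq_square)
      finally show ?thesis using True by (simp add: ennreal_leI)
    qed simp
  qed
  also have "\<dots> = ennreal (?k * (L b - L a))"
    using assms Lab by (intro nn_integral_L_length) auto
  finally show ?thesis by (simp add: power2_eq_square mult_ac)
qed

lemma cost_last_le:
  assumes H0: "\<forall>t\<in>{0..<1}. 0 \<le> H t"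
    and H: "\<forall>t\<in>{0..<1}. H t \<le> c1 * (L t powr (- \<alpha>) / (1 - t))"
    and "0 \<le> a" "a < 1" "1 / 2 < \<alpha>"
  shows "(\<integral>\<^sup>+t\<in>{a..<1}. ennreal ((1 - t) * (H t)\<^sup>2) \<partial>lborel)
    \<le> ennreal (c1\<^sup>2 * (L a powr (1 - 2 * \<alpha>) / (2 * \<alpha> - 1)))"
proof -
  let ?f = "\<lambda>t. L t powr (- (2 * \<alpha>)) / (1 - t)"
  have "(\<integral>\<^sup>+t\<in>{a..<1}. ennreal ((1 - t) * (H t)\<^sup>2) \<partial>lborel)
      \<le> (\<integral>\<^sup>+t. ennreal (c1\<^sup>2) * (ennreal (?f t) * indicator {a..<1} t) \<partial>lborel)"
  proof (rule nn_integral_mono)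
    fix t
    show "ennreal ((1 - t) * (H t)\<^sup>2) * indicator {a..<1} t
        \<le> ennreal (c1\<^sup>2) * (ennreal (?f t) * indicator {a..<1} t)"
    proof (cases "t \<in> {a..<1}")
      case True
      then have t: "0 \<le> t" "t < 1" using assms by auto
      have "(H t)\<^sup>2 \<le> (c1 * (L t powr (- \<alpha>) / (1 - t)))\<^sup>2"
        using H0 H t by (intro power_mono) auto
      also have "\<dots> = c1\<^sup>2 * (L t powr (- (2 * \<alpha>)) / (1 - t)\<^sup>2)"
        using square_of_model[OF t] by (simp only: power_mult_distrib)
      finally have "(1 - t) * (H t)\<^sup>2 \<le> (1 - t) * \<dots>"
        using t by (intro mult_left_mono) auto
      also have "\<dots> = c1\<^sup>2 * ?f t"
        using t by (simp add: power2_eq_square)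
      finally show ?thesis
        using True t by (simp add: ennreal_leI ennreal_mult[symmetric])
    qed simp
  qed
  also have "\<dots> = ennreal (c1\<^sup>2) * (\<integral>\<^sup>+t\<in>{a..<1}. ennreal (?f t) \<partial>lborel)"
    by (rule nn_integral_cmult) (simp add: L_def)
  also have "\<dots> \<le> ennreal (c1\<^sup>2) * ennreal (L a powr (1 - 2 * \<alpha>) / (2 * \<alpha> - 1))"
    using nn_integral_model_tail assms by (intro mult_left_mono) auto
  finally show ?thesis using assms by (simp add: ennreal_mult[symmetric])
qed

text \<open>
  The step of the optimal net. With \<open>p - 1 = \<alpha> * p\<close> the right-hand side is proportional to
  \<open>(x powr p) powr \<alpha>\<close>, the value at the left end of the interval. The mean value theorem gives the
  derivative at a point up to \<open>x + q \<le> 2 * x\<close>, which explains the factor \<open>2 powr (p - 1)\<close>.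
\<close>

lemma powr_step_le:
  fixes x q p :: real
  assumes "1 \<le> x" "0 \<le> q" "q \<le> 1" "1 \<le> p"
  shows "(x + q) powr p - x powr p \<le> p * 2 powr (p - 1) * q * x powr (p - 1)"
proof (cases "q = 0")
  case False
  have "\<exists>z. x < z \<and> z < x + q \<and>
      (x + q) powr p - x powr p = (x + q - x) * (p * z powr (p - 1))"
    using assms False by (intro MVT2) (auto intro!: derivative_eq_intros)
  then obtain z where z: "x < z" "z < x + q"
    and eq: "(x + q) powr p - x powr p = q * (p * z powr (p - 1))" by auto
  have "z powr (p - 1) \<le> (2 * x) powr (p - 1)"
    using z assms by (intro powr_mono2) auto
  also have "\<dots> = 2 powr (p - 1) * x powr (p - 1)"
    using assms by (simp add: powr_mult)
  finally have "q * (p * z powr (p - 1)) \<le> q * (p * (2 powr (p - 1) * x powr (p - 1)))"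
    using assms by (intro mult_left_mono) auto
  with eq show ?thesis by (simp add: mult_ac)
qed simp

text \<open>
  The first term comes from the bounded intervals of the net, the second one from the tail.
\<close>

definition upper_const :: "real \<Rightarrow> real" where
  "upper_const \<alpha> = (1 / (1 - \<alpha>) * 2 powr (1 / (1 - \<alpha>) - 1))\<^sup>2 + 1 / (2 * \<alpha> - 1)"

lemma A_le:
  assumes \<alpha>: "1 / 2 < \<alpha>" "\<alpha> < 1" and c1: "1 \<le> c1" and n: "1 \<le> n"
    and H0: "\<forall>t\<in>{0..<1}. 0 \<le> H t"
    and H: "\<forall>t\<in>{0..<1}. H t \<le> c1 * (L t powr (- \<alpha>) / (1 - t))"
  shows "A n H \<le> ennreal (c1 * sqrt (upper_const \<alpha>) / sqrt (real n powr (2 * \<alpha> - 1)))"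
proof -
  define p where "p = 1 / (1 - \<alpha>)"
  define q where "q = real n powr (- \<alpha>)"
  define x where "x i = 1 + real i * q" for i
  \<comment> \<open>On the logarithmic scale the net consists of the points \<open>x i powr p\<close>.\<close>
  define \<tau> where "\<tau> i = (if i < n then L_inv (x i powr p) else 1)" for i
  define K where "K = p * 2 powr (p - 1)"
  have p: "1 \<le> p" "p - 1 = \<alpha> * p" using \<alpha> by (auto simp: p_def field_simps)
  have q: "0 < q" "q \<le> 1"
    using n \<alpha> powr_mono[of "- \<alpha>" 0 "real n"] by (auto simp: q_def)
  have x1: "1 \<le> x i" for i using q by (simp add: x_def)
  have xS: "x (Suc i) = x i + q" for i by (simp add: x_def algebra_simps)
  have L\<tau>: "L (\<tau> i) = x i powr p" if "i < n" for i using that by (simp add: \<tau>_def)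
  have \<tau>1: "\<tau> i < 1" if "i < n" for i using that by (simp add: \<tau>_def L_inv_less_1)
  have step: "\<tau> i < \<tau> (Suc i)" if "i < n" for i
  proof (cases "Suc i < n")
    case True
    have "x i powr p < x (Suc i) powr p"
      using x1[of i] p q by (intro powr_less_mono2) (auto simp: xS)
    then show ?thesis using True by (simp add: \<tau>_def)
  qed (use that \<tau>1 in \<open>auto simp: \<tau>_def\<close>)
  have \<tau>0: "\<tau> 0 = 0" using n by (simp add: \<tau>_def x_def L_inv_def)
  have net: "\<tau> \<in> nets n"
    using \<tau>0 step by (auto simp: nets_def \<tau>_def)
  have \<tau>_nonneg: "0 \<le> \<tau> i" if "i < n" for i
    using that
  proof (induction i)
    case (Suc i)
    then show ?case using step[of i] by simp
  qed (simp add: \<tau>0)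
  let ?R = "real n powr (- (2 * \<alpha>))"
  let ?cost = "\<lambda>i. \<integral>\<^sup>+t\<in>{\<tau> (i - 1)..<\<tau> i}. ennreal ((\<tau> i - t) * (H t)\<^sup>2) \<partial>lborel"
  have inner: "?cost i \<le> ennreal (c1\<^sup>2 * (K\<^sup>2 * ?R))" if i: "i \<in> {1..<n}" for i
  proof -
    obtain j where j: "i = Suc j" using i by (cases i) auto
    have "?cost i \<le> ennreal (c1\<^sup>2 * (L (\<tau> i) - L (\<tau> j))\<^sup>2 * L (\<tau> j) powr (- (2 * \<alpha>)))"
      unfolding j diff_Suc_1
      using H0 H i j \<alpha> step[of j] by (intro cost_le_L_diff_square \<tau>1 \<tau>_nonneg) auto
    also have "\<dots> \<le> ennreal (c1\<^sup>2 * (K\<^sup>2 * ?R))"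
    proof (rule ennreal_leI)
      have "(L (\<tau> i) - L (\<tau> j)) \<le> K * q * x j powr (p - 1)"
        using powr_step_le[of "x j" q p] x1[of j] q p i j by (simp add: L\<tau> xS K_def)
      moreover have "0 \<le> L (\<tau> i) - L (\<tau> j)"
        using step[of j] \<tau>1[of i] i j by (simp add: L_mono)
      ultimately have "(L (\<tau> i) - L (\<tau> j))\<^sup>2 \<le> (K * q * x j powr (p - 1))\<^sup>2"
        by (intro power_mono)
      then have "(L (\<tau> i) - L (\<tau> j))\<^sup>2 * L (\<tau> j) powr (- (2 * \<alpha>))
          \<le> (K * q * x j powr (p - 1))\<^sup>2 * L (\<tau> j) powr (- (2 * \<alpha>))"
        by (intro mult_right_mono) auto
      also have "\<dots> = K\<^sup>2 * q\<^sup>2 * ((x j powr (\<alpha> * p))\<^sup>2 * (x j powr p) powr (- (2 * \<alpha>)))"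
        using i j by (simp add: L\<tau> p(2) power_mult_distrib)
      also have "(x j powr (\<alpha> * p))\<^sup>2 * (x j powr p) powr (- (2 * \<alpha>)) = 1"
        using x1[of j] by (simp add: power2_eq_square powr_powr powr_add[symmetric])
      also have "q\<^sup>2 = ?R"
        by (simp add: q_def power2_eq_square powr_add[symmetric])
      finally show "c1\<^sup>2 * (L (\<tau> i) - L (\<tau> j))\<^sup>2 * L (\<tau> j) powr (- (2 * \<alpha>))
          \<le> c1\<^sup>2 * (K\<^sup>2 * ?R)"
        by (simp add: mult.assoc mult_left_mono)
    qed
    finally show ?thesis .
  qed
  have nR: "real n * ?R = real n powr (1 - 2 * \<alpha>)"
    using n powr_add[of "real n" 1 "- (2 * \<alpha>)"] by simp
  have last: "?cost n \<le> ennreal (c1\<^sup>2 * (real n powr (1 - 2 * \<alpha>) / (2 * \<alpha> - 1)))"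
  proof -
    \<comment> \<open>The last but one net point lies at \<open>n\<close> or beyond: \<open>x (n - 1) = 1 - q + n * q \<ge> n * q = n powr (1 - \<alpha>)\<close>.\<close>
    have "real n = (real n powr (1 - \<alpha>)) powr p"
      using n \<alpha> by (simp add: powr_powr p_def)
    also have "real n powr (1 - \<alpha>) = real n * q"
      using n powr_add[of "real n" 1 "- \<alpha>"] by (simp add: q_def)
    also have "(real n * q) powr p \<le> x (n - 1) powr p"
      using q p n by (intro powr_mono2) (auto simp: x_def of_nat_diff algebra_simps)
    finally have Lge: "real n \<le> L (\<tau> (n - 1))" using n by (simp add: L\<tau>)
    have \<tau>n: "\<tau> n = 1" by (simp add: \<tau>_def)
    have "?cost n \<le> ennreal (c1\<^sup>2 * (L (\<tau> (n - 1)) powr (1 - 2 * \<alpha>) / (2 * \<alpha> - 1)))"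
      unfolding \<tau>n using H0 H n \<alpha> by (intro cost_last_le \<tau>1 \<tau>_nonneg) auto
    also have "\<dots> \<le> ennreal (c1\<^sup>2 * (real n powr (1 - 2 * \<alpha>) / (2 * \<alpha> - 1)))"
      using Lge n \<alpha>
      by (intro ennreal_leI mult_left_mono divide_right_mono powr_mono2') auto
    finally show ?thesis .
  qed
  have "(\<Sum>i=1..n. ?cost i) = (\<Sum>i\<in>{1..<n}. ?cost i) + ?cost n"
    using n by (simp add: sum.last_plus add.commute)
  also have "\<dots> \<le> (\<Sum>i\<in>{1..<n}. ennreal (c1\<^sup>2 * (K\<^sup>2 * ?R)))
      + ennreal (c1\<^sup>2 * (real n powr (1 - 2 * \<alpha>) / (2 * \<alpha> - 1)))"
    by (intro add_mono sum_mono inner last)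
  also have "\<dots> = ennreal (real (n - 1) * (c1\<^sup>2 * (K\<^sup>2 * ?R))
      + c1\<^sup>2 * (real n powr (1 - 2 * \<alpha>) / (2 * \<alpha> - 1)))"
    using \<alpha> by (subst sum_ennreal) auto
  also have "\<dots> \<le> ennreal (real n * (c1\<^sup>2 * (K\<^sup>2 * ?R))
      + c1\<^sup>2 * (real n powr (1 - 2 * \<alpha>) / (2 * \<alpha> - 1)))"
    by (intro ennreal_leI add_right_mono mult_right_mono) auto
  also have "real n * (c1\<^sup>2 * (K\<^sup>2 * ?R)) + c1\<^sup>2 * (real n powr (1 - 2 * \<alpha>) / (2 * \<alpha> - 1))
      = c1\<^sup>2 * upper_const \<alpha> * real n powr (1 - 2 * \<alpha>)"
    unfolding nR[symmetric] upper_const_def K_def p_def by (simp add: algebra_simps)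
  also have "\<dots> = (c1 * sqrt (upper_const \<alpha>) / sqrt (real n powr (2 * \<alpha> - 1)))\<^sup>2"
    using \<alpha> powr_minus_divide[of "real n" "2 * \<alpha> - 1"]
    by (simp add: power_divide power_mult_distrib upper_const_def)
  finally have "esqrt (\<Sum>i=1..n. ?cost i)
      \<le> ennreal (c1 * sqrt (upper_const \<alpha>) / sqrt (real n powr (2 * \<alpha> - 1)))"
    using c1 \<alpha> by (intro esqrt_le_ennrealI) (auto simp: upper_const_def)
  then show ?thesis
    unfolding A_def using net by (meson INF_lower2)
qed

section \<open>Lower bound\<close>

text \<open>
  The interval \<open>[a',b')\<close> is the part of \<open>[a,b)\<close> on which \<open>H\<close> is controlled. Its last unit of
  logarithmic length is given away. Before it the gap \<open>b' - t\<close> is at least \<open>(1 - 1/e) * (1 - t)\<close>,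
  hence at least \<open>(1 - t) / 2\<close>, so that the integrand is at least \<open>m / 2\<close> on the logarithmic
  scale. The loss of \<open>1\<close> does not depend on the interval, so \<open>n\<close> intervals lose \<open>n\<close> in total.
\<close>

lemma cost_ge_L_diff:
  fixes H :: "real \<Rightarrow> real"
  assumes "a \<le> a'" "a' \<le> b'" "b' \<le> b" "b' < 1" "0 \<le> m"
    and H: "\<And>t. a' \<le> t \<Longrightarrow> t < b' \<Longrightarrow> m / (1 - t)\<^sup>2 \<le> (H t)\<^sup>2"
  shows "ennreal (m / 2 * (L b' - L a' - 1))
    \<le> (\<integral>\<^sup>+t\<in>{a..<b}. ennreal ((b - t) * (H t)\<^sup>2) \<partial>lborel)"
proof (cases "L a' \<le> L b' - 1")
  case True
  define d where "d = L_inv (L b' - 1)"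
  have Ld: "L d = L b' - 1" and d1: "d < 1"
    by (simp_all add: d_def L_inv_less_1)
  have ad: "a' \<le> d"
    using True L_less_iff[of d a'] Ld d1 assms by linarith
  have db: "d < b'" using L_less_iff[of d b'] Ld d1 assms by linarith
  \<comment> \<open>Stepping back by \<open>1\<close> on the logarithmic scale multiplies the distance to \<open>1\<close> by \<open>e\<close>.\<close>
  have d_eq: "1 - d = exp 1 * (1 - b')"
    using assms by (simp add: d_def L_inv_def L_def exp_add exp_diff)
  have "ennreal (m / 2 * (L b' - L a' - 1)) = (\<integral>\<^sup>+t\<in>{a'..d}. ennreal (m / 2 / (1 - t)) \<partial>lborel)"
    using ad d1 assms by (subst nn_integral_L_length) (auto simp: Ld algebra_simps)
  also have "\<dots> \<le> (\<integral>\<^sup>+t\<in>{a..<b}. ennreal ((b - t) * (H t)\<^sup>2) \<partial>lborel)"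
  proof (rule nn_integral_mono)
    fix t
    show "ennreal (m / 2 / (1 - t)) * indicator {a'..d} t
        \<le> ennreal ((b - t) * (H t)\<^sup>2) * indicator {a..<b} t"
    proof (cases "t \<in> {a'..d}")
      case True
      then have t: "a' \<le> t" "t \<le> d" "t < b'" "t < 1" "t \<in> {a..<b}"
        using assms db d1 by auto
      have "2 * (1 - b') \<le> exp 1 * (1 - b')"
        using exp_ge_add_one_self[of 1] assms by (intro mult_right_mono) auto
      then have "(1 - t) / 2 \<le> b - t"
        using d_eq t assms by argo
      then have "(1 - t) / 2 * (m / (1 - t)\<^sup>2) \<le> (b - t) * (H t)\<^sup>2"
        using H[of t] t assms by (intro mult_mono) auto
      also have "(1 - t) / 2 * (m / (1 - t)\<^sup>2) = m / 2 / (1 - t)"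
        using t by (simp add: power2_eq_square)
      finally show ?thesis using True t by (simp add: ennreal_leI)
    qed simp
  qed
  finally show ?thesis .
next
  case False
  then have "m / 2 * (L b' - L a' - 1) \<le> 0"
    using assms by (intro mult_nonneg_nonpos) auto
  then show ?thesis by (simp add: ennreal_neg)
qed

lemma ennreal_sum_le_sum_ennreal: "ennreal (sum f I) \<le> (\<Sum>i\<in>I. ennreal (f i))"
proof -
  have "ennreal (sum f I) \<le> ennreal (\<Sum>i\<in>I. max 0 (f i))"
    by (intro ennreal_leI sum_mono) auto
  also have "\<dots> = (\<Sum>i\<in>I. ennreal (max 0 (f i)))"
    by (rule sum_ennreal[symmetric]) auto
  also have "\<dots> = (\<Sum>i\<in>I. ennreal (f i))"
    by (intro sum.cong) (auto simp: max_def ennreal_neg)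
  finally show ?thesis .
qed

lemma le_A:
  assumes \<alpha>: "0 \<le> \<alpha>" and s: "0 \<le> s" "s < 1" and c2: "1 \<le> c2" and n: "1 \<le> n"
    and H: "\<forall>t\<in>{s..<1}. 1 / c2 * (L t powr (- \<alpha>) / (1 - t)) \<le> H t"
  shows "ennreal (1 / (2 * c2 * (L s + 2) powr \<alpha>) * (1 / sqrt (real n powr (2 * \<alpha> - 1)))) \<le> A n H"
  unfolding A_def
proof (rule INF_greatest)
  fix \<tau> assume net: "\<tau> \<in> nets n"
  let ?cost = "\<lambda>i. \<integral>\<^sup>+t\<in>{\<tau> (i - 1)..<\<tau> i}. ennreal ((\<tau> i - t) * (H t)\<^sup>2) \<partial>lborel"
  define v where "v = L_inv (L s + 2 * real n)"
  \<comment> \<open>The net is clamped to the window \<open>[s,v]\<close>, so that the clamped lengths add up to \<open>2 * n\<close>.\<close>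
  define cl where "cl i = max s (min v (\<tau> i))" for i
  define m where "m = (L v powr (- \<alpha>) / c2)\<^sup>2"
  have Lv: "L v = L s + 2 * real n" and v1: "v < 1"
    by (simp_all add: v_def L_inv_less_1)
  have sv: "s < v" using L_less_iff[of s v] Lv v1 s n by simp
  have Ls: "1 \<le> L s" using L_ge_1 s by simp
  have \<tau>0: "\<tau> 0 = 0" and \<tau>n: "\<tau> n = 1" and step: "\<And>i. i < n \<Longrightarrow> \<tau> i < \<tau> (Suc i)"
    using net by (auto simp: nets_def)
  have cl: "s \<le> cl i" "cl i \<le> v" for i using sv by (auto simp: cl_def)
  have H2: "m / (1 - t)\<^sup>2 \<le> (H t)\<^sup>2" if "s \<le> t" "t < v" for t
  proof -
    have t: "0 \<le> t" "t < 1" using that s v1 by auto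
    have "L v powr (- \<alpha>) \<le> L t powr (- \<alpha>)"
      using \<alpha> that t v1 L_ge_1[OF t] L_mono[of t v] by (intro powr_mono2') auto
    then have "L v powr (- \<alpha>) / c2 / (1 - t) \<le> L t powr (- \<alpha>) / c2 / (1 - t)"
      using t c2 by (intro divide_right_mono) auto
    also have "\<dots> = 1 / c2 * (L t powr (- \<alpha>) / (1 - t))" by simp
    also have "\<dots> \<le> H t" using H that t by auto
    finally have "(L v powr (- \<alpha>) / c2 / (1 - t))\<^sup>2 \<le> (H t)\<^sup>2"
      using t c2 by (intro power_mono) auto
    then show ?thesis by (simp add: m_def power_divide power_mult_distrib)
  qed
  have cost: "ennreal (m / 2 * (L (cl i) - L (cl (i - 1)) - 1)) \<le> ?cost i" if i: "i \<in> {1..n}" for i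
  proof -
    have lt: "\<tau> (i - 1) < \<tau> i" using step[of "i - 1"] i by (cases i) auto
    then have mono: "cl (i - 1) \<le> cl i" by (auto simp: cl_def)
    show ?thesis
    proof (cases "cl (i - 1) < cl i")
      case True
      then have "\<tau> (i - 1) \<le> cl (i - 1)" "cl i \<le> \<tau> i"
        using sv by (auto simp: cl_def)
      then show ?thesis
        using mono cl[of i] cl[of "i - 1"] v1
        by (intro cost_ge_L_diff H2) (auto simp: m_def)
    next
      case False
      then have "m / 2 * (L (cl i) - L (cl (i - 1)) - 1) \<le> 0"
        using mono by (simp add: m_def)
      then show ?thesis by (simp add: ennreal_neg)
    qed
  qed
  have tele: "(\<Sum>i=1..n. L (cl i) - L (cl (i - 1)) - 1) = real n"
  proof -
    have "(\<Sum>i=1..n. L (cl i) - L (cl (i - 1)) - 1)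
        = (\<Sum>i=Suc 0..n. L (cl i) - L (cl (i - 1))) - real n"
      by (simp add: sum_subtractf)
    also have "(\<Sum>i=Suc 0..n. L (cl i) - L (cl (i - 1))) = L (cl n) - L (cl 0)"
      by (rule sum_telescope'') simp
    also have "cl n = v" using sv v1 \<tau>n by (simp add: cl_def)
    also have "cl 0 = s" using sv s \<tau>0 by (simp add: cl_def)
    finally show ?thesis by (simp add: Lv)
  qed
  show "ennreal (1 / (2 * c2 * (L s + 2) powr \<alpha>) * (1 / sqrt (real n powr (2 * \<alpha> - 1))))
    \<le> esqrt (\<Sum>i=1..n. ?cost i)"
  proof (rule ennreal_le_esqrtI)
    have n0: "0 < real n" using n by simp
    \<comment> \<open>As \<open>n \<ge> 1\<close>, the window ends at or before \<open>(L s + 2) * n\<close>; this bounds \<open>m\<close> below by a multiple of \<open>n powr (- 2\<alpha>)\<close>.\<close>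
    have "L s * 1 \<le> L s * real n" using Ls n by (intro mult_left_mono) auto
    then have "L v \<le> (L s + 2) * real n"
      by (simp add: Lv algebra_simps)
    then have "((L s + 2) * real n) powr (- \<alpha>) \<le> L v powr (- \<alpha>)"
      using \<alpha> Ls Lv n by (intro powr_mono2') auto
    then have "(((L s + 2) * real n) powr (- \<alpha>) / c2)\<^sup>2 \<le> m"
      unfolding m_def using c2 by (intro power_mono divide_right_mono) auto
    moreover have "0 \<le> m" by (simp add: m_def)
    ultimately have "(((L s + 2) * real n) powr (- \<alpha>) / c2)\<^sup>2 / 4 \<le> m / 2"
      by linarith
    then have "(((L s + 2) * real n) powr (- \<alpha>) / c2)\<^sup>2 / 4 * real n \<le> m / 2 * real n"
      by (rule mult_right_mono) simp
    moreover have "(1 / (2 * c2 * (L s + 2) powr \<alpha>) * (1 / sqrt (real n powr (2 * \<alpha> - 1))))\<^sup>2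
        = (((L s + 2) * real n) powr (- \<alpha>) / c2)\<^sup>2 / 4 * real n"
    proof -
      have "real n powr (2 * \<alpha> - 1) = (real n powr \<alpha>)\<^sup>2 / real n"
        using n0 by (simp add: powr_diff power2_eq_square powr_add[symmetric])
      then show ?thesis
        using Ls n0 by (simp add: powr_mult powr_minus_divide power_divide power_mult_distrib)
    qed
    ultimately have "ennreal ((1 / (2 * c2 * (L s + 2) powr \<alpha>) * (1 / sqrt (real n powr (2 * \<alpha> - 1))))\<^sup>2)
        \<le> ennreal (m / 2 * real n)"
      by (simp only: ennreal_leI)
    also have "m / 2 * real n = (\<Sum>i=1..n. m / 2 * (L (cl i) - L (cl (i - 1)) - 1))"
      by (simp only: tele sum_distrib_left[symmetric])
    also have "ennreal \<dots> \<le> (\<Sum>i=1..n. ennreal (m / 2 * (L (cl i) - L (cl (i - 1)) - 1)))"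
      by (rule ennreal_sum_le_sum_ennreal)
    also have "\<dots> \<le> (\<Sum>i=1..n. ?cost i)"
      by (intro sum_mono cost)
    finally show "ennreal ((1 / (2 * c2 * (L s + 2) powr \<alpha>) * (1 / sqrt (real n powr (2 * \<alpha> - 1))))\<^sup>2)
        \<le> (\<Sum>i=1..n. ?cost i)" .
  qed (use c2 in auto)
qed

section \<open>The two-sided rate\<close>

theorem theorem2p5:
  fixes \<alpha> :: real
  assumes "1 / 2 < \<alpha>" and "\<alpha> < 1"
  shows
    "(\<forall>c1::real. c1 \<ge> 1 \<longrightarrow>
       (\<exists>c::real. c \<ge> 1 \<and>
         (\<forall>H::real \<Rightarrow> real.
            (\<forall>t\<in>{0..<1}. 0 \<le> H t) \<and> mono_on {0..<1} H \<and>
            (\<forall>t\<in>{0..<1}. H t \<le> c1 * ((1 - ln (1 - t)) powr (- \<alpha>) / (1 - t))) \<longrightarrow>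
            (\<forall>n::nat. n \<ge> 1 \<longrightarrow>
               A n H \<le> ennreal (c / sqrt (real n powr (2 * \<alpha> - 1)))))))
     \<and>
     (\<forall>s::real. \<forall>c2::real. 0 \<le> s \<and> s < 1 \<and> c2 \<ge> 1 \<longrightarrow>
       (\<exists>c::real. c \<ge> 1 \<and>
         (\<forall>H::real \<Rightarrow> real.
            (\<forall>t\<in>{0..<1}. 0 \<le> H t) \<and> mono_on {0..<1} H \<and>
            (\<forall>t\<in>{s..<1}. 1 / c2 * ((1 - ln (1 - t)) powr (- \<alpha>) / (1 - t)) \<le> H t) \<longrightarrow>
            (\<forall>n::nat. n \<ge> 1 \<longrightarrow>
               ennreal (1 / c * (1 / sqrt (real n powr (2 * \<alpha> - 1)))) \<le> A n H))))"
proof (intro conjI allI impI)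
  fix c1 :: real assume c1: "1 \<le> c1"
  define c where "c = max 1 (c1 * sqrt (upper_const \<alpha>))"
  have "A n H \<le> ennreal (c / sqrt (real n powr (2 * \<alpha> - 1)))"
    if H0: "\<forall>t\<in>{0..<1}. 0 \<le> H t"
      and H: "\<forall>t\<in>{0..<1}. H t \<le> c1 * ((1 - ln (1 - t)) powr (- \<alpha>) / (1 - t))"
      and n: "1 \<le> n" for H and n :: nat
  proof -
    have "A n H \<le> ennreal (c1 * sqrt (upper_const \<alpha>) / sqrt (real n powr (2 * \<alpha> - 1)))"
      by (rule A_le) (use assms c1 n H0 H in \<open>auto simp: L_def\<close>)
    also have "\<dots> \<le> ennreal (c / sqrt (real n powr (2 * \<alpha> - 1)))"
      by (intro ennreal_leI divide_right_mono) (auto simp: c_def)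
    finally show ?thesis .
  qed
  then show "\<exists>c::real. c \<ge> 1 \<and>
      (\<forall>H::real \<Rightarrow> real.
         (\<forall>t\<in>{0..<1}. 0 \<le> H t) \<and> mono_on {0..<1} H \<and>
         (\<forall>t\<in>{0..<1}. H t \<le> c1 * ((1 - ln (1 - t)) powr (- \<alpha>) / (1 - t))) \<longrightarrow>
         (\<forall>n::nat. n \<ge> 1 \<longrightarrow>
            A n H \<le> ennreal (c / sqrt (real n powr (2 * \<alpha> - 1)))))"
    by (intro exI[of _ c]) (simp add: c_def)
next
  fix s c2 :: real assume sc: "0 \<le> s \<and> s < 1 \<and> 1 \<le> c2"
  define c where "c = 2 * c2 * (L s + 2) powr \<alpha>"
  have "1 \<le> (L s + 2) powr \<alpha>"
    using L_ge_1[of s] sc assms by (intro ge_one_powr_ge_zero) auto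
  then have c: "1 \<le> c"
    using mult_mono[of 1 "2 * c2" 1 "(L s + 2) powr \<alpha>"] sc by (simp add: c_def)
  have "ennreal (1 / c * (1 / sqrt (real n powr (2 * \<alpha> - 1)))) \<le> A n H"
    if H: "\<forall>t\<in>{s..<1}. 1 / c2 * ((1 - ln (1 - t)) powr (- \<alpha>) / (1 - t)) \<le> H t"
      and n: "1 \<le> n" for H and n :: nat
    unfolding c_def by (rule le_A) (use assms sc n H in \<open>auto simp: L_def\<close>)
  with c show "\<exists>c::real. c \<ge> 1 \<and>
      (\<forall>H::real \<Rightarrow> real.
         (\<forall>t\<in>{0..<1}. 0 \<le> H t) \<and> mono_on {0..<1} H \<and>
         (\<forall>t\<in>{s..<1}. 1 / c2 * ((1 - ln (1 - t)) powr (- \<alpha>) / (1 - t)) \<le> H t) \<longrightarrow>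
         (\<forall>n::nat. n \<ge> 1 \<longrightarrow>
            ennreal (1 / c * (1 / sqrt (real n powr (2 * \<alpha> - 1)))) \<le> A n H))"
    by (intro exI[of _ c]) simp
qed

end
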